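(* Let $s\ge 1$ and $n\ge 12s^2$ be integers. Then $$\mathrm{ex}(n,\{F_{3,2},M_{s+1}^3\})=s\binom{n-s}{2},$$ and $\mathcal{H}(n,s)$ is the unique extremal construction; that is, up to isomorphism, $\mathcal{H}(n,s)$ is the only $n$-vertex $3$-graph with $s\binom{n-s}{2}$ edges that contains neither $F_{3,2}$ nor $M_{s+1}^3$.
   Context: A $3$-graph is a $3$-uniform hypergraph. For a family $\mathcal{F}$ of $3$-graphs, $\mathrm{ex}(n,\mathcal{F})$ is the maximum number of edges in an $n$-vertex $3$-graph containing no member of $\mathcal{F}$ as a (not necessarily induced) subgraph. $M_{s+1}^3$ is the $3$-graph consisting of $s+1$ pairwise disjoint edges. $F_{3,2}$ is the $3$-graph on vertex set $\{1,2,3,4,5\}$ with edge set $\{123,145,245,345\}$. $\mathcal{H}(n,s)$ is the $3$-graph on $A\cup B$, where $A,B$ are disjoint with $|A|=s$ and $|B|=n-s$, whose edges are all triples with exactly one vertex in $A$ and two vertices in $B$. *)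

theory Defs
  imports Main
begin

record 'a hypergraph =
  verts :: "'a set"
  edges :: "'a set set"

definition three_graph :: "'a hypergraph \<Rightarrow> bool" where
  "three_graph G \<longleftrightarrow> finite (verts G) \<and> (\<forall>e\<in>edges G. e \<subseteq> verts G \<and> card e = 3)"

(* Not necessarily induced. *)
definition contains_copy :: "'a hypergraph \<Rightarrow> 'b hypergraph \<Rightarrow> bool" where
  "contains_copy G F \<longleftrightarrow>
     (\<exists>f. inj_on f (verts F) \<and> f ` verts F \<subseteq> verts G \<and> (\<forall>e\<in>edges F. f ` e \<in> edges G))"

definition family_free :: "'a hypergraph \<Rightarrow> 'b hypergraph set \<Rightarrow> bool" where
  "family_free G \<F> \<longleftrightarrow> (\<forall>F\<in>\<F>. \<not> contains_copy G F)"

definition isomorphic :: "'a hypergraph \<Rightarrow> 'b hypergraph \<Rightarrow> bool" where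
  "isomorphic G H \<longleftrightarrow>
     (\<exists>f. bij_betw f (verts G) (verts H) \<and> edges H = (\<lambda>e. f ` e) ` edges G)"

(* Host graphs have natural numbers as vertices, which covers every finite
   hypergraph up to isomorphism and leaves the vertex type out of the type of ex. *)
definition free_sizes :: "nat \<Rightarrow> 'b hypergraph set \<Rightarrow> nat set" where
  "free_sizes n \<F> =
     {card (edges G) | G :: nat hypergraph. three_graph G \<and> card (verts G) = n \<and> family_free G \<F>}"

definition ex :: "nat \<Rightarrow> 'b hypergraph set \<Rightarrow> nat" where
  "ex n \<F> = Max (free_sizes n \<F>)"

(* Max is therefore a genuine maximum as soon as some n-vertex 3-graph is free. *)
lemma finite_free_sizes: "finite (free_sizes n \<F>)"
proof (rule finite_subset)
  show "free_sizes n \<F> \<subseteq> {..2 ^ n}"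
  proof
    fix m assume "m \<in> free_sizes n \<F>"
    then obtain G :: "nat hypergraph"
      where G: "m = card (edges G)" "three_graph G" "card (verts G) = n"
      by (auto simp: free_sizes_def)
    have "edges G \<subseteq> Pow (verts G)" "finite (Pow (verts G))"
      using G(2) by (auto simp: three_graph_def)
    then have "card (edges G) \<le> card (Pow (verts G))"
      by (rule card_mono[rotated])
    then show "m \<in> {..2 ^ n}"
      using G by (simp add: card_Pow three_graph_def)
  qed
qed simp

definition F32 :: "nat hypergraph" where
  "F32 = \<lparr>verts = {1, 2, 3, 4, 5}, edges = {{1, 2, 3}, {1, 4, 5}, {2, 4, 5}, {3, 4, 5}}\<rparr>"

(* The 3-graph M_k^3 of k pairwise disjoint edges. *)
definition matching3 :: "nat \<Rightarrow> nat hypergraph" where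
  "matching3 k = \<lparr>verts = {..<3 * k}, edges = {{3 * i, 3 * i + 1, 3 * i + 2} | i. i < k}\<rparr>"

definition one_two_graph :: "'a set \<Rightarrow> 'a set \<Rightarrow> 'a hypergraph" where
  "one_two_graph A B =
     \<lparr>verts = A \<union> B, edges = {e. e \<subseteq> A \<union> B \<and> card (e \<inter> A) = 1 \<and> card (e \<inter> B) = 2}\<rparr>"

(* The intended range is s \<le> n. *)
definition H_graph :: "nat \<Rightarrow> nat \<Rightarrow> nat hypergraph" where
  "H_graph n s = one_two_graph {..<s} {s..<n}"

end

theory Submission
  imports Defs
begin

text \<open>
  Suppose an \<open>n\<close>-vertex \<open>G\<close> has no \<open>s + 1\<close> disjoint edges and at least \<open>s (n - s choose 2)\<close> edges.
  Some \<open>s\<close>-set \<open>L\<close> of vertices then meets every edge. For \<open>s \<ge> 2\<close>, \<open>L\<close> consists of the vertices of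
  degree above \<open>3 s n\<close>: a greedy choice of disjoint edges through such vertices shows that there are at
  most \<open>s\<close> of them and that they meet all edges if there are exactly \<open>s\<close>; with fewer of them \<open>G\<close> would
  have too few edges. For \<open>s = 1\<close>, an intersecting family without a common vertex is shown to be small.

  Let \<open>B\<close> be the complement of \<open>L\<close>. Every edge with at least two vertices in \<open>L\<close> forces triples with
  exactly one vertex in \<open>L\<close> to be missing, since the common neighbourhood of a pair spans no edge
  in an \<open>F\<^sub>3\<^sub>,\<^sub>2\<close>-free graph. If there is any such edge, more triples are missing than there are such
  edges, so \<open>G\<close> is the graph of all triples with one vertex in \<open>L\<close> and two in \<open>B\<close>.
\<close>

section \<open>Degrees and codegrees: \<open>edges_over\<close> at a singleton or at a pair\<close>

definition edges_over :: "'a hypergraph \<Rightarrow> 'a set \<Rightarrow> 'a set set" where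
  "edges_over G S = {e \<in> edges G. S \<subseteq> e}"

lemma three_graphD:
  assumes "three_graph G"
  shows "finite (verts G)" and "e \<in> edges G \<Longrightarrow> e \<subseteq> verts G"
    and "e \<in> edges G \<Longrightarrow> card e = 3" and "e \<in> edges G \<Longrightarrow> finite e"
    and "finite (edges G)"
proof -
  show fV: "finite (verts G)" and sub: "\<And>e. e \<in> edges G \<Longrightarrow> e \<subseteq> verts G"
    and "e \<in> edges G \<Longrightarrow> card e = 3"
    using assms by (auto simp: three_graph_def)
  show "e \<in> edges G \<Longrightarrow> finite e" using fV sub finite_subset by blast
  have "edges G \<subseteq> Pow (verts G)" using sub by auto
  then show "finite (edges G)" using fV by (meson finite_Pow_iff finite_subset)
qed

lemma triple_of_members:
  assumes "card e = 3" "a \<in> e" "b \<in> e" "c \<in> e" "a \<noteq> b" "a \<noteq> c" "b \<noteq> c"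
  shows "e = {a, b, c}"
proof -
  have "finite e" using assms(1) by (metis card.infinite zero_neq_numeral)
  then show ?thesis
    using card_subset_eq[of e "{a, b, c}"] assms by auto
qed

lemma finite_edges_over: "three_graph G \<Longrightarrow> finite (edges_over G S)"
  unfolding edges_over_def by (simp add: three_graphD(5))

text \<open>An edge through \<open>a\<close> and \<open>x\<close> is determined by its third vertex,
  and meeting \<open>T\<close> forces that vertex into \<open>T\<close>. Applied with
  \<open>T\<close> the rest of the vertex set, and with \<open>T\<close> an edge avoiding the pair
  in an intersecting family.\<close>

lemma card_edges_over_pair_le:
  assumes G: "three_graph G" and "a \<noteq> x" and T: "finite T" "a \<notin> T" "x \<notin> T"
    and meet: "\<And>e. e \<in> edges_over G {a, x} \<Longrightarrow> e \<inter> T \<noteq> {}"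
  shows "card (edges_over G {a, x}) \<le> card T"
proof -
  have "edges_over G {a, x} \<subseteq> (\<lambda>c. {a, x, c}) ` T"
  proof
    fix e assume e: "e \<in> edges_over G {a, x}"
    then obtain c where c: "c \<in> e" "c \<in> T" using meet by blast
    have "card e = 3" "a \<in> e" "x \<in> e"
      using e three_graphD(3)[OF G] by (auto simp: edges_over_def)
    then have "e = {a, x, c}" using c T assms(2) triple_of_members[of e a x c] by metis
    then show "e \<in> (\<lambda>c. {a, x, c}) ` T" using c by blast
  qed
  then show ?thesis by (rule surj_card_le[OF T(1)])
qed

lemma codegree_le:
  assumes G: "three_graph G" and "a \<noteq> x" "a \<in> verts G" "x \<in> verts G"
  shows "card (edges_over G {a, x}) \<le> card (verts G) - 2"
proof -
  have "card (edges_over G {a, x}) \<le> card (verts G - {a, x})"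
  proof (rule card_edges_over_pair_le[OF G assms(2)])
    fix e assume "e \<in> edges_over G {a, x}"
    then have e: "e \<in> edges G" by (auto simp: edges_over_def)
    have "\<not> e \<subseteq> {a, x}"
      using card_mono[of "{a, x}" e] three_graphD(3)[OF G e] assms(2) by auto
    then show "e \<inter> (verts G - {a, x}) \<noteq> {}" using three_graphD(2)[OF G e] by blast
  qed (use three_graphD(1)[OF G] in auto)
  also have "\<dots> = card (verts G) - 2"
    using assms by (subst card_Diff_subset) auto
  finally show ?thesis .
qed

lemma degree_le:
  assumes G: "three_graph G" and v: "v \<in> verts G"
  shows "card (edges_over G {v}) \<le> (card (verts G) - 1) choose 2"
proof -
  let ?P = "{p. p \<subseteq> verts G - {v} \<and> card p = 2}"
  have fin: "finite (verts G - {v})" using three_graphD(1)[OF G] by auto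
  have "edges_over G {v} \<subseteq> insert v ` ?P"
  proof
    fix e assume e: "e \<in> edges_over G {v}"
    then have "e - {v} \<in> ?P" "e = insert v (e - {v})"
      using three_graphD(2-4)[OF G, of e] by (auto simp: edges_over_def)
    then show "e \<in> insert v ` ?P" by blast
  qed
  moreover have "finite ?P" using fin by auto
  ultimately have "card (edges_over G {v}) \<le> card ?P" by (metis surj_card_le)
  also have "\<dots> = (card (verts G) - 1) choose 2"
    using n_subsets[OF fin, of 2] v by simp
  finally show ?thesis .
qed

subsection \<open>Matchings and copies of the forbidden graphs\<close>

text \<open>The edges through \<open>v\<close> that meet \<open>T\<close> are spread over the pairs
  \<open>{v, t}\<close>, each of codegree at most \<open>card (verts G)\<close>, so they cannot
  exhaust the degree of \<open>v\<close>.\<close>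

lemma edge_avoiding:
  assumes G: "three_graph G" and v: "v \<in> verts G" and T: "T \<subseteq> verts G" "v \<notin> T"
    and deg: "card (edges_over G {v}) > card T * card (verts G)"
  shows "\<exists>e\<in>edges G. v \<in> e \<and> e \<inter> T = {}"
proof (rule ccontr)
  assume "\<not> ?thesis"
  then have sub: "edges_over G {v} \<subseteq> (\<Union>t\<in>T. edges_over G {v, t})"
    by (fastforce simp: edges_over_def)
  have fT: "finite T" using T three_graphD(1)[OF G] finite_subset by blast
  have "card (edges_over G {v}) \<le> card (\<Union>t\<in>T. edges_over G {v, t})"
    using sub fT finite_edges_over[OF G] by (intro card_mono) auto
  also have "\<dots> \<le> (\<Sum>t\<in>T. card (edges_over G {v, t}))" by (rule card_UN_le[OF fT])
  also have "\<dots> \<le> (\<Sum>t\<in>T. card (verts G))"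
  proof (rule sum_mono)
    fix t assume "t \<in> T"
    then have "card (edges_over G {v, t}) \<le> card (verts G) - 2"
      using codegree_le[OF G, of v t] v T by auto
    then show "card (edges_over G {v, t}) \<le> card (verts G)" by simp
  qed
  finally show False using deg by simp
qed

lemma card_Union_matching_le:
  assumes "three_graph G" "M \<subseteq> edges G"
  shows "card (\<Union>M) \<le> 3 * card M"
proof -
  have "finite M" using assms three_graphD(5) finite_subset by blast
  then have "card (\<Union>M) \<le> (\<Sum>e\<in>M. card e)" using card_UN_le[of M "\<lambda>e. e"] by simp
  also have "\<dots> = (\<Sum>e\<in>M. 3)" using assms three_graphD(3) by (intro sum.cong) auto
  finally show ?thesis by simp
qed

text \<open>The vertices of \<open>K\<close> are treated one at a time. Each new edge avoids the
  vertices already covered and also the rest of \<open>K\<close>, so the later vertices stay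
  available. The degree threshold is what \<open>edge_avoiding\<close> needs for up to
  \<open>3 * s\<close> forbidden vertices.\<close>

lemma greedy_matching:
  assumes G: "three_graph G" and "finite K" "K \<subseteq> verts G"
    and "\<And>v. v \<in> K \<Longrightarrow> card (edges_over G {v}) > 3 * s * card (verts G)"
    and "M \<subseteq> edges G" "pairwise disjnt M" "\<Union>M \<inter> K = {}" "card M + card K \<le> s + 1"
  shows "\<exists>M'\<subseteq>edges G. pairwise disjnt M' \<and> card M' = card M + card K"
  using assms(2-)
proof (induction K arbitrary: M rule: finite_induct)
  case empty
  then show ?case by (intro exI[of _ M]) simp
next
  case (insert v K)
  let ?T = "\<Union>M \<union> K"
  have finM: "finite M" using finite_subset[OF insert.prems(3) three_graphD(5)[OF G]] .
  have cM: "card (\<Union>M) \<le> 3 * card M"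
    using card_Union_matching_le[OF G insert.prems(3)] .
  have "card ?T \<le> card (\<Union>M) + card K" by (rule card_Un_le)
  \<comment> \<open>The bound \<open>s + 1\<close> also counts \<open>v\<close>, so
    \<open>card M + card K \<le> s\<close> here.\<close>
  also have "\<dots> \<le> 3 * s"
    using cM insert.prems(6) insert.hyps by simp
  finally have "card ?T * card (verts G) \<le> 3 * s * card (verts G)" by simp
  moreover have "card (edges_over G {v}) > 3 * s * card (verts G)" using insert.prems by simp
  ultimately have "card ?T * card (verts G) < card (edges_over G {v})" by linarith
  moreover have "?T \<subseteq> verts G" "v \<in> verts G" "v \<notin> ?T"
    using insert.hyps insert.prems(1,3,5) three_graphD(2)[OF G] by auto
  ultimately obtain e where e: "e \<in> edges G" "v \<in> e" "e \<inter> ?T = {}"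
    using edge_avoiding[OF G, of v ?T] by blast
  have new: "e \<notin> M" using e(2,3) by auto
  have "\<exists>M'\<subseteq>edges G. pairwise disjnt M' \<and> card M' = card (insert e M) + card K"
  proof (rule insert.IH)
    show "pairwise disjnt (insert e M)"
    proof -
      have "\<forall>y\<in>M. disjnt e y \<and> disjnt y e" using e(3) unfolding disjnt_def by blast
      then show ?thesis using insert.prems(4) by (simp add: pairwise_insert)
    qed
    show "\<Union>(insert e M) \<inter> K = {}" using e(3) insert.prems(5) by auto
    show "card (insert e M) + card K \<le> s + 1"
      using insert.prems(6) insert.hyps finM new by simp
  qed (use insert.prems(1-3) e(1) in auto)
  then show ?case using insert.hyps finM new by simp
qed

lemma matching_copy:
  assumes G: "three_graph G" and M: "M \<subseteq> edges G" "pairwise disjnt M" "card M = k"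
  shows "contains_copy G (matching3 k)"
proof -
  have finM: "finite M" using M three_graphD(5)[OF G] finite_subset by blast
  obtain g where g: "bij_betw g {..<k} M"
    using ex_bij_betw_nat_finite[OF finM] M by (auto simp: atLeast0LessThan)
  have "\<forall>e\<in>M. \<exists>h. bij_betw h {..<3::nat} e"
    using M(1) three_graphD(3,4)[OF G] ex_bij_betw_nat_finite
    by (metis atLeast0LessThan subsetD)
  then obtain h where h: "\<And>e. e \<in> M \<Longrightarrow> bij_betw (h e) {..<3::nat} e" by metis
  \<comment> \<open>Vertex \<open>i\<close> of the matching goes to vertex number
    \<open>i mod 3\<close> of edge number \<open>i div 3\<close>. Disjointness of the edges recovers
    the quotient, injectivity of the enumeration \<open>h\<close> the remainder.\<close>
  define f where "f i = h (g (i div 3)) (i mod 3)" for i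
  have gM: "g i \<in> M" if "i < k" for i using g that bij_betwE by blast
  have fin: "f i \<in> g (i div 3)" if "i < 3 * k" for i
    using bij_betwE[OF h[OF gM[of "i div 3"]]] that by (auto simp: f_def)
  have "inj_on f {..<3 * k}"
  proof (rule inj_onI)
    fix i j assume ij: "i \<in> {..<3 * k}" "j \<in> {..<3 * k}" "f i = f j"
    have lt: "i div 3 < k" "j div 3 < k" using ij by auto
    have "g (i div 3) = g (j div 3)"
    proof (rule ccontr)
      assume "g (i div 3) \<noteq> g (j div 3)"
      then have "disjnt (g (i div 3)) (g (j div 3))"
        using M(2) gM lt unfolding pairwise_def by blast
      then show False using fin[of i] fin[of j] ij by (auto simp: disjnt_def)
    qed
    moreover from this have "i div 3 = j div 3"
      using g lt by (auto simp: bij_betw_def inj_on_def)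
    moreover have "i mod 3 = j mod 3"
    proof -
      have "inj_on (h (g (i div 3))) {..<3}" using h[OF gM[OF lt(1)]] bij_betw_def by blast
      then show ?thesis using ij(3) calculation by (auto simp: f_def inj_on_def)
    qed
    ultimately show "i = j" by (metis div_mult_mod_eq)
  qed
  moreover have "f ` {..<3 * k} \<subseteq> verts G"
  proof
    fix u assume "u \<in> f ` {..<3 * k}"
    then obtain i where i: "u = f i" "i < 3 * k" by auto
    then have "u \<in> g (i div 3)" "g (i div 3) \<in> edges G"
      using fin[OF i(2)] gM[of "i div 3"] M(1) by auto
    then show "u \<in> verts G" using three_graphD(2)[OF G] by blast
  qed
  moreover have "f ` {3 * i, 3 * i + 1, 3 * i + 2} \<in> edges G" if "i < k" for i
  proof -
    have "{..<3} = {0, 1, 2::nat}" by auto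
    then have "h (g i) ` {0, 1, 2} = g i" using h[OF gM[OF that]] by (simp add: bij_betw_def)
    moreover have "f ` {3 * i, 3 * i + 1, 3 * i + 2} = h (g i) ` {0, 1, 2}"
    proof -
      have "3 * i div 3 = i" "(3 * i + 1) div 3 = i" "(3 * i + 2) div 3 = i"
        "3 * i mod 3 = 0" "(3 * i + 1) mod 3 = 1" "(3 * i + 2) mod 3 = 2" by presburger+
      then have "f (3 * i) = h (g i) 0" "f (3 * i + 1) = h (g i) 1" "f (3 * i + 2) = h (g i) 2"
        unfolding f_def by (simp_all only:)
      then show ?thesis by (simp only: image_insert image_empty)
    qed
    ultimately show ?thesis using gM[OF that] M(1) by auto
  qed
  then have "\<forall>e\<in>{{3 * i, 3 * i + 1, 3 * i + 2} |i. i < k}. f ` e \<in> edges G" by blast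
  ultimately show ?thesis
    unfolding contains_copy_def matching3_def hypergraph.simps by blast
qed

lemma matching_card_le:
  assumes G: "three_graph G" and free: "\<not> contains_copy G (matching3 (s + 1))"
    and M: "M \<subseteq> edges G" "pairwise disjnt M"
  shows "card M \<le> s"
proof (rule ccontr)
  assume "\<not> card M \<le> s"
  then obtain M' where "M' \<subseteq> M" "card M' = s + 1"
    by (metis Suc_eq_plus1 not_less_eq_eq obtain_subset_with_card_n)
  then show False using matching_copy[OF G, of M' "s + 1"] M free pairwise_mono by blast
qed

text \<open>Here \<open>p\<close> and \<open>q\<close> play 4 and 5. This is the form in which
  freeness is used: three common neighbours of a pair never form an edge.\<close>

lemma F32_copy:
  assumes G: "three_graph G" and d: "distinct [a, b, c, p, q]"
    and E: "{a, b, c} \<in> edges G" "{a, p, q} \<in> edges G" "{b, p, q} \<in> edges G" "{c, p, q} \<in> edges G"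
  shows "contains_copy G F32"
proof -
  define f where "f i = (if i = 1 then a else if i = 2 then b else if i = 3 then c
    else if i = (4::nat) then p else q)" for i
  have "inj_on f {1, 2, 3, 4, 5}" using d by (auto simp: f_def inj_on_def)
  moreover have "f ` {1, 2, 3, 4, 5} \<subseteq> verts G"
    using E three_graphD(2)[OF G] by (auto simp: f_def)
  ultimately show ?thesis
    unfolding contains_copy_def F32_def using E by (intro exI[of _ f]) (auto simp: f_def insert_commute)
qed

subsection \<open>Vertex covers\<close>

lemma card_edges_meeting_le:
  assumes G: "three_graph G" and L: "L \<subseteq> verts G"
    and deg: "\<And>v. v \<in> L \<Longrightarrow> card (edges_over G {v}) \<le> d"
  shows "card {e \<in> edges G. e \<inter> L \<noteq> {}} \<le> card L * d"
proof -
  have fL: "finite L" using finite_subset[OF L three_graphD(1)[OF G]] .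
  have "{e \<in> edges G. e \<inter> L \<noteq> {}} = (\<Union>v\<in>L. edges_over G {v})"
    by (auto simp: edges_over_def)
  then have "card {e \<in> edges G. e \<inter> L \<noteq> {}} \<le> (\<Sum>v\<in>L. card (edges_over G {v}))"
    using card_UN_le[OF fL] by metis
  also have "\<dots> \<le> (\<Sum>v\<in>L. d)" by (rule sum_mono) (rule deg)
  finally show ?thesis by simp
qed

lemma two_times_choose_two: "2 * (n choose 2) = n * (n - 1)"
  unfolding choose_two by (cases n) auto

text \<open>The left side bounds the number of edges when only \<open>l\<close> vertices have large
  degree: each of these has degree at most \<open>(n - 1) choose 2\<close>, and at most
  \<open>3 * (s - l)\<close> further vertices of degree at most \<open>3 * s * n\<close> meet the
  remaining edges. After doubling and passing to integers, \<open>l = s - 1\<close> is the worst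
  case.\<close>

lemma large_degree_arith:
  fixes n s l :: nat
  assumes s: "s \<ge> 2" and n: "n \<ge> 12 * s\<^sup>2" and l: "l < s"
  shows "l * ((n - 1) choose 2) + 3 * (s - l) * (3 * s * n) < s * ((n - s) choose 2)"
proof -
  have "s * s \<ge> 2 * s" using s by (rule mult_right_mono) simp
  then have ns: "n \<ge> 24 * s" using n unfolding power2_eq_square by linarith
  define N S r where "N = int n" and "S = int s" and "r = int (s - l)"
  note defs = N_def S_def r_def
  have r: "1 \<le> r" "r \<le> S" "int l = S - r" using l unfolding defs by auto
  have S2: "2 \<le> S" using s by (simp add: defs)
  have N: "12 * (S * S) \<le> N" "24 * S \<le> N"
    using n ns unfolding defs by (simp_all add: power2_eq_square flip: of_nat_mult)
  have "(S - r) * ((N - 1) * (N - 2)) + 18 * r * S * N < S * ((N - S) * (N - S - 1))"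
  proof -
    \<comment> \<open>Raising \<open>r\<close> by one lowers the left side by this amount, so
      \<open>r = 1\<close> maximizes it.\<close>
    have c: "(N - 1) * (N - 2) - 18 * S * N \<ge> 0"
    proof -
      have "18 * S * N + 3 * N \<le> N * N"
        using mult_right_mono[of "18 * S + 3" N N] N S2 by (simp add: algebra_simps)
      then show ?thesis by (simp add: algebra_simps)
    qed
    have "(r - 1) * ((N - 1) * (N - 2) - 18 * S * N) \<ge> 0" using c r by simp
    then have "(S - r) * ((N - 1) * (N - 2)) + 18 * r * S * N
      \<le> (S - 1) * ((N - 1) * (N - 2)) + 18 * S * N" by (simp add: algebra_simps)
    also have "\<dots> < S * ((N - S) * (N - S - 1))"
    proof -
      \<comment> \<open>At \<open>r = 1\<close> the right side minus the left side is \<open>N * N -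
        (2 * (S * S) + 16 * S + 3) * N + S * S * S + S * S - 2 * S + 2\<close>; the final 2 makes
        the inequality strict.\<close>
      have "2 * (S * S) + 16 * S + 3 \<le> N"
      proof -
        have "10 * (S * S) \<ge> 20 * S" using mult_right_mono[OF S2, of S] S2 by simp
        then show ?thesis using N S2 by linarith
      qed
      then have "(2 * (S * S) + 16 * S + 3) * N \<le> N * N"
        using N S2 by (intro mult_right_mono) auto
      moreover have "2 * S \<le> S * S * S + S * S"
        using mult_right_mono[OF S2, of S] S2 by (smt (verit) mult_nonneg_nonneg)
      ultimately show ?thesis by (simp add: algebra_simps)
    qed
    finally show ?thesis .
  qed
  moreover have "int (2 * (l * ((n - 1) choose 2) + 3 * (s - l) * (3 * s * n)))
    = (S - r) * ((N - 1) * (N - 2)) + 18 * r * S * N"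
  proof -
    have "int (2 * ((n - 1) choose 2)) = (N - 1) * (N - 2)"
      unfolding two_times_choose_two using ns s by (simp add: defs of_nat_diff)
    moreover have "int (2 * (l * c + 3 * q * (3 * s * n)))
      = int l * int (2 * c) + 18 * int q * S * N" for c q
      by (simp add: defs algebra_simps)
    from this[of "(n - 1) choose 2" "s - l"]
    have "int (2 * (l * ((n - 1) choose 2) + 3 * (s - l) * (3 * s * n)))
      = int l * int (2 * ((n - 1) choose 2)) + 18 * r * S * N"
      by (simp only: r_def)
    ultimately show ?thesis using r by simp
  qed
  moreover have "int (2 * (s * ((n - s) choose 2))) = S * ((N - S) * (N - S - 1))"
  proof -
    have "int (2 * ((n - s) choose 2)) = (N - S) * (N - S - 1)"
      unfolding two_times_choose_two using ns s by (simp add: defs of_nat_diff)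
    then show ?thesis by (simp add: defs)
  qed
  ultimately have "int (2 * (l * ((n - 1) choose 2) + 3 * (s - l) * (3 * s * n)))
    < int (2 * (s * ((n - s) choose 2)))" by (simp only:)
  then show ?thesis by (simp only: of_nat_less_iff mult_less_cancel1)
qed

lemma vertex_cover_of_size_ge_2:
  assumes G: "three_graph G" and s: "s \<ge> 2" and n: "card (verts G) \<ge> 12 * s\<^sup>2"
    and nu: "\<And>M. M \<subseteq> edges G \<Longrightarrow> pairwise disjnt M \<Longrightarrow> card M \<le> s"
    and large: "card (edges G) \<ge> s * ((card (verts G) - s) choose 2)"
  shows "\<exists>L\<subseteq>verts G. card L = s \<and> (\<forall>e\<in>edges G. e \<inter> L \<noteq> {})"
proof -
  let ?n = "card (verts G)"
  define L where "L = {v \<in> verts G. card (edges_over G {v}) > 3 * s * ?n}"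
  have LV: "L \<subseteq> verts G" by (auto simp: L_def)
  have fL: "finite L" using finite_subset[OF LV three_graphD(1)[OF G]] .
  \<comment> \<open>Used three times: with \<open>M\<close> empty to bound \<open>card L\<close>,
    with \<open>K = L\<close> to bound matchings that avoid \<open>L\<close>, and with
    \<open>K = L\<close>, \<open>M = {e}\<close> to show that \<open>L\<close> meets every edge once
    it has \<open>s\<close> vertices.\<close>
  have greedy: "card M + card K \<le> s"
    if K: "K \<subseteq> L" and M: "M \<subseteq> edges G" "pairwise disjnt M" "\<Union>M \<inter> L = {}"
      and le: "card M + card K \<le> s + 1" for K M
  proof -
    have "\<exists>M'\<subseteq>edges G. pairwise disjnt M' \<and> card M' = card M + card K"
    proof (rule greedy_matching[OF G _ _ _ M(1,2) _ le])
      show "finite K" using finite_subset[OF K fL] .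
    qed (use K M(3) LV in \<open>auto simp: L_def\<close>)
    then show ?thesis using nu by metis
  qed
  have "card L \<le> s"
  proof (rule ccontr)
    assume "\<not> card L \<le> s"
    then obtain K where "K \<subseteq> L" "card K = s + 1"
      by (metis Suc_eq_plus1 not_less_eq_eq obtain_subset_with_card_n)
    then show False using greedy[of K "{}"] by simp
  qed
  moreover have "\<not> card L < s"
  proof
    assume less: "card L < s"
    have small: "card M \<le> s - card L"
      if M: "M \<subseteq> edges G" "pairwise disjnt M" "\<Union>M \<inter> L = {}" for M
    proof (rule ccontr)
      assume "\<not> card M \<le> s - card L"
      \<comment> \<open>Trimming \<open>M\<close> brings the total to exactly \<open>s + 1\<close>,
        the largest value that \<open>greedy\<close> admits.\<close>
      then obtain M' where M': "M' \<subseteq> M" "card M' = s + 1 - card L"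
        using obtain_subset_with_card_n[of "s + 1 - card L" M] less
        by (metis Suc_diff_le Suc_eq_plus1 less_imp_le not_less_eq_eq)
      have "card M' + card L \<le> s"
      proof (rule greedy)
        show "pairwise disjnt M'" using pairwise_mono[OF M(2) _ M'(1)] by blast
      qed (use M' M less in auto)
      then show False using M' less by simp
    qed
    define P where "P M \<longleftrightarrow> M \<subseteq> edges G \<and> pairwise disjnt M \<and> \<Union>M \<inter> L = {}" for M
    have P0: "P {}" by (simp add: P_def)
    have bound: "\<forall>M. P M \<longrightarrow> card M < s + 1"
    proof (intro allI impI)
      fix M assume "P M"
      then have "card M \<le> s - card L" using small[of M] by (simp add: P_def)
      then show "card M < s + 1" by simp
    qed
    \<comment> \<open>By maximality of this matching off \<open>L\<close>, every edge meets
      \<open>L\<close> or the union of \<open>M\<close>. The latter has at most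
      \<open>3 * (s - card L)\<close> vertices, none of large degree.\<close>
    from ex_has_greatest_nat[OF P0 bound]
    obtain M where PM: "P M" and max: "\<And>M'. P M' \<Longrightarrow> card M' \<le> card M" by blast
    have M: "M \<subseteq> edges G" "pairwise disjnt M" "\<Union>M \<inter> L = {}" using PM by (auto simp: P_def)
    have finM: "finite M" using finite_subset[OF M(1) three_graphD(5)[OF G]] .
    have cover: "e \<inter> L \<noteq> {} \<or> e \<inter> \<Union>M \<noteq> {}" if e: "e \<in> edges G" for e
    proof (rule ccontr)
      assume con: "\<not> ?thesis"
      have "e \<noteq> {}" using three_graphD(3)[OF G e] by auto
      then have new: "e \<notin> M" using con by auto
      have "\<forall>y\<in>M. disjnt e y \<and> disjnt y e" using con unfolding disjnt_def by blast
      then have "P (insert e M)" using e con M by (auto simp: P_def pairwise_insert)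
      then show False using max[of "insert e M"] finM new by simp
    qed
    define U where "U = \<Union>M"
    have UV: "U \<subseteq> verts G" using M(1) three_graphD(2)[OF G] unfolding U_def by blast
    have cU: "card U \<le> 3 * (s - card L)"
      using card_Union_matching_le[OF G M(1)] small[OF M] unfolding U_def by simp
    have "edges G \<subseteq> {e \<in> edges G. e \<inter> L \<noteq> {}} \<union> {e \<in> edges G. e \<inter> U \<noteq> {}}"
      using cover unfolding U_def by blast
    then have "card (edges G)
      \<le> card ({e \<in> edges G. e \<inter> L \<noteq> {}} \<union> {e \<in> edges G. e \<inter> U \<noteq> {}})"
      using three_graphD(5)[OF G] by (intro card_mono) auto
    also have "\<dots> \<le> card {e \<in> edges G. e \<inter> L \<noteq> {}} + card {e \<in> edges G. e \<inter> U \<noteq> {}}"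
      by (rule card_Un_le)
    also have "\<dots> \<le> card L * ((?n - 1) choose 2) + card U * (3 * s * ?n)"
    proof (rule add_mono)
      show "card {e \<in> edges G. e \<inter> L \<noteq> {}} \<le> card L * ((?n - 1) choose 2)"
        by (rule card_edges_meeting_le[OF G LV]) (use degree_le[OF G] LV in blast)
      show "card {e \<in> edges G. e \<inter> U \<noteq> {}} \<le> card U * (3 * s * ?n)"
      proof (rule card_edges_meeting_le[OF G UV])
        fix v assume "v \<in> U"
        then have "v \<in> verts G" "v \<notin> L" using UV M(3) by (auto simp: U_def)
        then show "card (edges_over G {v}) \<le> 3 * s * ?n" unfolding L_def by simp
      qed
    qed
    also have "\<dots> \<le> card L * ((?n - 1) choose 2) + 3 * (s - card L) * (3 * s * ?n)"
      using mult_right_mono[OF cU, of "3 * s * ?n"] by simp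
    also have "\<dots> < s * ((?n - s) choose 2)" by (rule large_degree_arith[OF s n less])
    finally show False using large by simp
  qed
  ultimately have cL: "card L = s" by simp
  have "e \<inter> L \<noteq> {}" if e: "e \<in> edges G" for e
    using greedy[of L "{e}"] e cL by auto
  then show ?thesis using LV cL by blast
qed

text \<open>Without a common vertex there are two cases. If two vertices together meet all edges,
  there are at most \<open>5 * (n - 2)\<close> edges for \<open>n = card (verts G)\<close>;
  otherwise all codegrees are at most 3 and there are at most 27 edges. Both are below
  \<open>(n - 1) choose 2\<close> once \<open>n \<ge> 12\<close>.\<close>

lemma intersecting_common_vertex:
  assumes G: "three_graph G" and n: "card (verts G) \<ge> 12"
    and inter: "\<And>e f. e \<in> edges G \<Longrightarrow> f \<in> edges G \<Longrightarrow> e \<inter> f \<noteq> {}"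
    and large: "card (edges G) \<ge> (card (verts G) - 1) choose 2"
  shows "\<exists>a\<in>verts G. \<forall>e\<in>edges G. a \<in> e"
proof (rule ccontr)
  assume none: "\<not> ?thesis"
  let ?n = "card (verts G)"
  have "12 * 11 \<le> 2 * card (edges G) + 22"
  proof -
    have "11 * 10 \<le> (?n - 1) * (?n - 1 - 1)" using n by (intro mult_mono) auto
    then show ?thesis using two_times_choose_two[of "?n - 1"] large by linarith
  qed
  then have big: "card (edges G) > 27" by simp
  have miss: "\<exists>f\<in>edges G. a \<notin> f" if "a \<in> e" "e \<in> edges G" for a e
    using none that three_graphD(2)[OF G] by blast
  have branch: "card (edges G) \<le> card e * k"
    if e: "e \<in> edges G" and k: "\<And>a. a \<in> e \<Longrightarrow> card (edges_over G {a}) \<le> k" for e k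
  proof -
    have "edges G = {f \<in> edges G. f \<inter> e \<noteq> {}}" using inter e by auto
    then show ?thesis
      using card_edges_meeting_le[OF G three_graphD(2)[OF G e] k] by simp
  qed
  \<comment> \<open>Every edge through \<open>a\<close> meets the edge \<open>f\<close>, so it
    contains one of the three pairs formed by \<open>a\<close> and a vertex of
    \<open>f\<close>.\<close>
  have deg: "card (edges_over G {a}) \<le> 3 * k"
    if f: "f \<in> edges G" "a \<notin> f"
      and k: "\<And>x. x \<in> f \<Longrightarrow> card (edges_over G {a, x}) \<le> k" for a f k
  proof -
    have ff: "finite f" using three_graphD(4)[OF G f(1)] .
    have "edges_over G {a} \<subseteq> (\<Union>x\<in>f. edges_over G {a, x})"
      using inter f(1) by (fastforce simp: edges_over_def)
    then have "card (edges_over G {a}) \<le> card (\<Union>x\<in>f. edges_over G {a, x})"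
      using ff finite_edges_over[OF G] by (intro card_mono) auto
    also have "\<dots> \<le> (\<Sum>x\<in>f. card (edges_over G {a, x}))" by (rule card_UN_le[OF ff])
    also have "\<dots> \<le> (\<Sum>x\<in>f. k)" by (rule sum_mono) (rule k)
    finally show ?thesis using three_graphD(3)[OF G f(1)] by simp
  qed
  show False
  proof (cases "\<exists>a x. a \<noteq> x \<and> a \<in> verts G \<and> x \<in> verts G \<and> (\<forall>e\<in>edges G. a \<in> e \<or> x \<in> e)")
    case True
    then obtain a x where ax: "a \<noteq> x" "a \<in> verts G" "x \<in> verts G"
      "\<And>e. e \<in> edges G \<Longrightarrow> a \<in> e \<or> x \<in> e" by blast
    obtain f where f: "f \<in> edges G" "a \<notin> f" using none ax by blast
    obtain g where g: "g \<in> edges G" "x \<notin> g" using none ax by blast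
    have xf: "x \<in> f" and ag: "a \<in> g" using ax f g by auto
    \<comment> \<open>An edge with \<open>a\<close> but not \<open>x\<close> meets \<open>f\<close>
      outside \<open>x\<close>, and one with \<open>x\<close> but not \<open>a\<close> meets
      \<open>g\<close> outside \<open>a\<close>. With the pair \<open>{a, x}\<close> itself, this
      leaves five pairs of codegree at most \<open>?n - 2\<close>.\<close>
    let ?A = "\<Union>p\<in>f - {x}. edges_over G {a, p}" and ?X = "\<Union>p\<in>g - {a}. edges_over G {x, p}"
    have "edges G \<subseteq> edges_over G {a, x} \<union> ?A \<union> ?X"
    proof
      fix e assume e: "e \<in> edges G"
      show "e \<in> edges_over G {a, x} \<union> ?A \<union> ?X"
        using ax(4)[OF e] inter[OF e f(1)] inter[OF e g(1)] e f(2) g(2)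
        unfolding edges_over_def by blast
    qed
    moreover have fin: "finite f" "finite g" using three_graphD(4)[OF G] f g by auto
    ultimately have "card (edges G) \<le> card (edges_over G {a, x} \<union> ?A \<union> ?X)"
      using finite_edges_over[OF G] by (intro card_mono) auto
    also have "\<dots> \<le> card (edges_over G {a, x}) + card ?A + card ?X"
      by (meson add_le_mono card_Un_le le_refl le_trans)
    also have "\<dots> \<le> (?n - 2) + 2 * (?n - 2) + 2 * (?n - 2)"
    proof -
      have *: "card (\<Union>p\<in>h - {y}. edges_over G {z, p}) \<le> 2 * (?n - 2)"
        if h: "h \<in> edges G" "y \<in> h" "z \<notin> h" "z \<in> verts G" for h y z
      proof -
        have fh: "finite h" using three_graphD(4)[OF G h(1)] .
        have "card (\<Union>p\<in>h - {y}. edges_over G {z, p}) \<le> (\<Sum>p\<in>h - {y}. card (edges_over G {z, p}))"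
          using fh by (intro card_UN_le) auto
        also have "\<dots> \<le> (\<Sum>p\<in>h - {y}. ?n - 2)"
        proof (rule sum_mono)
          fix p assume "p \<in> h - {y}"
          then show "card (edges_over G {z, p}) \<le> ?n - 2"
            using codegree_le[OF G, of z p] h three_graphD(2)[OF G h(1)] by auto
        qed
        finally show ?thesis using h fh three_graphD(3)[OF G h(1)] by simp
      qed
      show ?thesis
        using codegree_le[OF G ax(1-3)] *[OF f(1) xf f(2) ax(2)] *[OF g(1) ag g(2) ax(3)]
        by linarith
    qed
    finally have "2 * card (edges G) \<le> 10 * (?n - 2)" by simp
    \<comment> \<open>This needs \<open>10 < ?n - 1\<close>, which is exactly
      \<open>?n \<ge> 12\<close>.\<close>
    also have "\<dots> < (?n - 1) * (?n - 1 - 1)" using n by (intro mult_less_le_imp_less) auto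
    also have "\<dots> \<le> 2 * card (edges G)"
      using two_times_choose_two[of "?n - 1"] large by linarith
    finally show False by simp
  next
    case False
    have codeg: "card (edges_over G {a, x}) \<le> 3"
      if ax: "a \<noteq> x" "a \<in> verts G" "x \<in> verts G" for a x
    proof -
      \<comment> \<open>Any edge through \<open>a\<close> and \<open>x\<close> must meet
        \<open>h\<close>, so its third vertex is one of the three vertices of
        \<open>h\<close>.\<close>
      obtain h where h: "h \<in> edges G" "a \<notin> h" "x \<notin> h" using False ax by blast
      have "card (edges_over G {a, x}) \<le> card h"
        by (rule card_edges_over_pair_le[OF G ax(1)])
          (use h three_graphD(4)[OF G] inter in \<open>auto simp: edges_over_def\<close>)
      then show ?thesis using three_graphD(3)[OF G h(1)] by simp
    qed
    have "edges G \<noteq> {}" using big by auto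
    then obtain e where e: "e \<in> edges G" by blast
    have "card (edges G) \<le> card e * (3 * 3)"
    proof (rule branch[OF e])
      fix a assume a: "a \<in> e"
      obtain f where f: "f \<in> edges G" "a \<notin> f" using miss[OF a e] by blast
      show "card (edges_over G {a}) \<le> 3 * 3"
      proof (rule deg[OF f])
        fix x assume "x \<in> f"
        then show "card (edges_over G {a, x}) \<le> 3"
          using codeg[of a x] three_graphD(2)[OF G] e a f by auto
      qed
    qed
    then show False using big three_graphD(3)[OF G e] by simp
  qed
qed

text \<open>The case \<open>s = 1\<close> is separate because the estimate of
  \<open>large_degree_arith\<close> would there read \<open>9 * n < (n - 1) choose 2\<close>, which
  fails at \<open>n = 12\<close>.\<close>

lemma vertex_cover_of_size:
  assumes G: "three_graph G" and s: "s \<ge> 1" and n: "card (verts G) \<ge> 12 * s\<^sup>2"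
    and nu: "\<And>M. M \<subseteq> edges G \<Longrightarrow> pairwise disjnt M \<Longrightarrow> card M \<le> s"
    and large: "card (edges G) \<ge> s * ((card (verts G) - s) choose 2)"
  shows "\<exists>L\<subseteq>verts G. card L = s \<and> (\<forall>e\<in>edges G. e \<inter> L \<noteq> {})"
proof (cases "s = 1")
  case True
  have "e \<inter> f \<noteq> {}" if ef: "e \<in> edges G" "f \<in> edges G" for e f
  proof
    assume dis: "e \<inter> f = {}"
    have "e \<noteq> {}" using three_graphD(3)[OF G ef(1)] by auto
    then have "e \<noteq> f" using dis by auto
    then have "card {e, f} = 2" by simp
    moreover have "pairwise disjnt {e, f}" using dis by (auto simp: pairwise_insert disjnt_def)
    ultimately show False using nu[of "{e, f}"] ef True by simp
  qed
  then obtain a where "a \<in> verts G" "\<forall>e\<in>edges G. a \<in> e"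
    using intersecting_common_vertex[OF G] n large True by auto
  then show ?thesis using True by (intro exI[of _ "{a}"]) auto
next
  case False
  then show ?thesis using vertex_cover_of_size_ge_2[OF G _ n nu large] s by simp
qed

subsection \<open>Missing triples\<close>

lemma card_pair_triples:
  assumes "finite A" "finite B" "A \<inter> B = {}"
  shows "card {e. e \<subseteq> A \<union> B \<and> card (e \<inter> A) = 1 \<and> card (e \<inter> B) = 2} = card A * (card B choose 2)"
proof -
  let ?P = "{p. p \<subseteq> B \<and> card p = 2}"
  have "{e. e \<subseteq> A \<union> B \<and> card (e \<inter> A) = 1 \<and> card (e \<inter> B) = 2} = (\<lambda>(a, p). insert a p) ` (A \<times> ?P)"
  proof (intro set_eqI iffI)
    fix e assume "e \<in> {e. e \<subseteq> A \<union> B \<and> card (e \<inter> A) = 1 \<and> card (e \<inter> B) = 2}"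
    then have e: "e \<subseteq> A \<union> B" "card (e \<inter> A) = 1" "card (e \<inter> B) = 2" by auto
    obtain a where a: "e \<inter> A = {a}" using e(2) card_1_singletonE by blast
    have "e = insert a (e \<inter> B)" "a \<in> A" using a e(1) by blast+
    then show "e \<in> (\<lambda>(a, p). insert a p) ` (A \<times> ?P)"
      using e(3) by (intro image_eqI[of _ _ "(a, e \<inter> B)"]) auto
  next
    fix e assume "e \<in> (\<lambda>(a, p). insert a p) ` (A \<times> ?P)"
    then obtain a p where ap: "e = insert a p" "a \<in> A" "p \<subseteq> B" "card p = 2" by auto
    then have "e \<inter> A = {a}" "e \<inter> B = p" "e \<subseteq> A \<union> B" using assms(3) by auto
    then show "e \<in> {e. e \<subseteq> A \<union> B \<and> card (e \<inter> A) = 1 \<and> card (e \<inter> B) = 2}"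
      using ap(4) by simp
  qed
  moreover have "inj_on (\<lambda>(a, p). insert a p) (A \<times> ?P)"
  proof (rule inj_onI, clarify)
    fix a p a' p' assume *: "a \<in> A" "p \<subseteq> B" "a' \<in> A" "p' \<subseteq> B" "insert a p = insert a' p'"
    then have "insert a p \<inter> A = {a}" "insert a' p' \<inter> A = {a'}"
      "insert a p \<inter> B = p" "insert a' p' \<inter> B = p'" using assms(3) by auto
    then show "a = a' \<and> p = p'" using *(5) by auto
  qed
  ultimately show ?thesis
    using n_subsets[OF assms(2), of 2] by (simp add: card_image card_cartesian_product)
qed

text \<open>Since \<open>L\<close> meets every edge, \<open>W\<close> collects the edges with at
  least two vertices in \<open>L\<close>. By \<open>F32_copy\<close> such edges exclude triples of
  the one-two graph, and in each case the excluded triples outnumber \<open>W\<close>.\<close>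

lemma heavy_edges_lt_missing:
  fixes G :: "'a hypergraph"
  assumes G: "three_graph G" and F: "\<not> contains_copy G F32"
    and L: "L \<subseteq> verts G" "card L = s" and n: "card (verts G) \<ge> 12 * s\<^sup>2"
    and cover: "\<And>e. e \<in> edges G \<Longrightarrow> e \<inter> L \<noteq> {}"
    and B: "B = verts G - L"
    and W: "W = edges G - edges (one_two_graph L B)" and "W \<noteq> {}"
  shows "card W < card (edges (one_two_graph L B) - edges G)"
proof -
  let ?n = "card (verts G)"
  define Miss where "Miss = edges (one_two_graph L B) - edges G"
  define m where "m = card B"
  \<comment> \<open>An upper bound for \<open>2 * card W\<close>: an edge of \<open>W\<close> is a
    pair in \<open>L\<close> plus one more vertex. A set of \<open>k\<close> vertices with
    \<open>k * (k - 1) > X\<close> therefore has more than \<open>card W\<close> pairs.\<close>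
  define X where "X = s * (s - 1) * ?n"
  have fV: "finite (verts G)" using three_graphD(1)[OF G] .
  have fL: "finite L" and fB: "finite B" and LB: "L \<inter> B = {}" "L \<union> B = verts G"
    using finite_subset[OF L(1) fV] fV B L by auto
  have fM: "finite Miss"
  proof -
    have "Miss \<subseteq> Pow (verts G)" using LB by (auto simp: Miss_def one_two_graph_def)
    then show ?thesis using fV by (meson finite_Pow_iff finite_subset)
  qed
  have m: "m + s = ?n"
    using card_Un_disjoint[OF fL fB LB(1)] LB(2) L(2) by (simp add: m_def)
  have MissI: "{y, c, d} \<in> Miss"
    if "y \<in> L" "c \<in> B" "d \<in> B" "c \<noteq> d" "{y, c, d} \<notin> edges G" for y c d
  proof -
    have "{y, c, d} \<inter> L = {y}" "{y, c, d} \<inter> B = {c, d}" "{y, c, d} \<subseteq> L \<union> B"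
      using that(1-3) LB(1) by auto
    then show ?thesis using that(4,5) unfolding Miss_def one_two_graph_def by simp
  qed
  have W2: "\<exists>x\<in>L. \<exists>y\<in>L. \<exists>c. x \<noteq> y \<and> c \<noteq> x \<and> c \<noteq> y \<and> c \<in> verts G \<and> e = {x, y, c}" if e: "e \<in> W" for e
  proof -
    have e': "e \<in> edges G" using e W by auto
    note E = three_graphD(2-4)[OF G e']
    have split: "(e \<inter> L) \<union> (e \<inter> B) = e" "(e \<inter> L) \<inter> (e \<inter> B) = {}"
      using E(1) LB by auto
    have "card (e \<inter> L) + card (e \<inter> B) = 3"
      using card_Un_disjoint[OF _ _ split(2)] E(2,3) unfolding split(1) by simp
    moreover have "card (e \<inter> L) \<noteq> 0" using cover[OF e'] E(3) by auto
    moreover have "\<not> (card (e \<inter> L) = 1 \<and> card (e \<inter> B) = 2)"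
      using e E(1) LB(2) unfolding W one_two_graph_def by simp
    ultimately have "card (e \<inter> L) \<ge> 2" by linarith
    then obtain T where T: "T \<subseteq> e \<inter> L" "card T = 2" using obtain_subset_with_card_n by metis
    then obtain x y where xy: "T = {x, y}" "x \<noteq> y" by (auto simp: card_2_iff)
    have "card (e - T) = 1" using T E by (subst card_Diff_subset) (auto intro: finite_subset)
    then obtain c where c: "e - T = {c}" using card_1_singletonE by blast
    then have "e = {x, y, c}" using T xy by auto
    then show ?thesis using xy T c E(1) by blast
  qed
  have s1: "s \<ge> 1"
  proof -
    obtain e where "e \<in> W" using assms(9) by blast
    then have "L \<noteq> {}" using W2 by blast
    then show ?thesis using L fL by (metis One_nat_def Suc_leI card_gt_0_iff)
  qed
  have ss: "s \<le> s * s" by simp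
  have n12: "12 * (s * s) \<le> ?n" using n by (simp add: power2_eq_square)
  have ns: "12 * s \<le> ?n" using n12 ss by linarith
  have W_le: "2 * card W \<le> X"
  proof -
    let ?P = "{p. p \<subseteq> L \<and> card p = 2}"
    have "W \<subseteq> (\<lambda>(p, c). insert c p) ` (?P \<times> verts G)"
    proof
      fix e assume "e \<in> W"
      then obtain x y c where "x \<in> L" "y \<in> L" "x \<noteq> y" "c \<in> verts G" "e = {x, y, c}"
        using W2 by blast
      then show "e \<in> (\<lambda>(p, c). insert c p) ` (?P \<times> verts G)"
        by (intro image_eqI[of _ _ "({x, y}, c)"]) auto
    qed
    moreover have "finite (?P \<times> verts G)" using fL fV by auto
    ultimately have "card W \<le> card (?P \<times> verts G)" by (rule surj_card_le[rotated])
    also have "\<dots> = (s choose 2) * ?n"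
      using n_subsets[OF fL, of 2] L by (simp add: card_cartesian_product)
    finally have "2 * card W \<le> 2 * (s choose 2) * ?n" by simp
    then show ?thesis by (simp add: X_def two_times_choose_two)
  qed
  \<comment> \<open>Each pair in \<open>S\<close> extends to a missing triple by a vertex of
    \<open>L\<close>. The pair is the trace of that triple on \<open>B\<close>, so distinct pairs
    give distinct missing triples.\<close>
  have pairs_missing: "card W < card Miss"
    if S: "S \<subseteq> B" "X < card S * (card S - 1)" "finite R" "R \<subseteq> L"
      and miss: "\<And>c d. c \<in> S \<Longrightarrow> d \<in> S \<Longrightarrow> c \<noteq> d \<Longrightarrow> \<exists>y\<in>R. {y, c, d} \<notin> edges G" for S R
  proof -
    let ?P = "{p. p \<subseteq> S \<and> card p = 2}"
    have fS: "finite S" using finite_subset[OF S(1) fB] .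
    have "?P \<subseteq> (\<lambda>e. e \<inter> B) ` Miss"
    proof
      fix p assume p: "p \<in> ?P"
      then obtain c d where cd: "p = {c, d}" "c \<noteq> d" by (auto simp: card_2_iff)
      then obtain y where y: "y \<in> R" "{y, c, d} \<notin> edges G" using miss p by blast
      have mem: "y \<in> L" "c \<in> B" "d \<in> B" using y S(1,4) cd p by auto
      then have "{y, c, d} \<in> Miss" using MissI cd(2) y(2) by simp
      moreover have "p = {y, c, d} \<inter> B" using mem LB(1) unfolding cd(1) by auto
      ultimately show "p \<in> (\<lambda>e. e \<inter> B) ` Miss" by blast
    qed
    then have "card ?P \<le> card Miss" using fM by (rule surj_card_le[rotated])
    then have "card S choose 2 \<le> card Miss" using n_subsets[OF fS, of 2] by simp
    then have "card S * (card S - 1) \<le> 2 * card Miss"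
      unfolding two_times_choose_two[symmetric] by simp
    then show ?thesis using W_le S(2) by linarith
  qed
  have Xn: "12 * X \<le> ?n * ?n"
  proof -
    have "s * (s - 1) \<le> s * s" by simp
    then have "12 * (s * (s - 1)) \<le> ?n" using n12 by linarith
    then have "12 * (s * (s - 1)) * ?n \<le> ?n * ?n" by (rule mult_right_mono) simp
    then show ?thesis by (simp add: X_def mult.assoc)
  qed
  \<comment> \<open>An edge inside \<open>L\<close>, or many neighbours of \<open>(x, b)\<close> in \<open>B\<close>, makes quadratically many
    triples missing. Otherwise each \<open>(x, b)\<close> in an edge \<open>{x, y, b}\<close> has few neighbours in \<open>B\<close>, so that
    linearly many triples \<open>{x, b, c}\<close> are missing, each counted at most twice.\<close>
  consider (inside) e where "e \<in> W" "e \<subseteq> L"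
    | (dense) x b y where "x \<in> L" "y \<in> L" "b \<in> B" "x \<noteq> y" "{x, y, b} \<in> edges G"
      "X < card {c \<in> B. {x, b, c} \<in> edges G} * (card {c \<in> B. {x, b, c} \<in> edges G} - 1)"
    | (sparse) "\<And>e. e \<in> W \<Longrightarrow> \<not> e \<subseteq> L"
      "\<And>x b y. x \<in> L \<Longrightarrow> y \<in> L \<Longrightarrow> b \<in> B \<Longrightarrow> x \<noteq> y \<Longrightarrow> {x, y, b} \<in> edges G \<Longrightarrow>
        card {c \<in> B. {x, b, c} \<in> edges G} * (card {c \<in> B. {x, b, c} \<in> edges G} - 1) \<le> X"
    by (meson not_less)
  then have "card W < card Miss"
  proof cases
    case inside
    then obtain x y z where xyz: "x \<noteq> y" "z \<noteq> x" "z \<noteq> y" "e = {x, y, z}" "{x, y, z} \<in> edges G"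
      using W2 W by blast
    show ?thesis
    proof (rule pairs_missing[of B e])
      \<comment> \<open>From \<open>12 * s \<le> ?n\<close> the set \<open>B\<close> contains at
        least 11/12 of the vertices, hence \<open>m * (m - 1)\<close> is at least 66/144 of
        \<open>?n * ?n\<close>, while \<open>X\<close> is at most 12/144 of it.\<close>
      have "6 * ?n \<le> 12 * (m - 1)" "11 * ?n \<le> 12 * m" using m ns s1 by linarith+
      then have "(6 * ?n) * (11 * ?n) \<le> (12 * (m - 1)) * (12 * m)" by (rule mult_mono) auto
      then have "66 * (?n * ?n) \<le> 144 * (m * (m - 1))" by (simp add: algebra_simps)
      moreover have "?n * ?n > 0" using ns s1 by auto
      ultimately show "X < card B * (card B - 1)" using Xn unfolding m_def by linarith
    next
      fix c d assume cd: "c \<in> B" "d \<in> B" "c \<noteq> d"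
      \<comment> \<open>If all three vertices of \<open>e\<close> formed edges with \<open>c\<close>
        and \<open>d\<close>, then \<open>e\<close> would be an edge among common neighbours of that
        pair.\<close>
      have "distinct [x, y, z, c, d]" using xyz cd inside LB by auto
      then show "\<exists>y\<in>e. {y, c, d} \<notin> edges G"
        using F32_copy[OF G _ xyz(5)] F xyz(4) by blast
    qed (use inside fL finite_subset in auto)
  next
    case dense
    let ?S = "{c \<in> B. {x, b, c} \<in> edges G}"
    have "b \<notin> ?S" using three_graphD(3)[OF G, of "{x, b, b}"] by (auto simp: card_insert_if split: if_splits)
    show ?thesis
    proof (rule pairs_missing[of ?S "{y}"])
      fix c d assume cd: "c \<in> ?S" "d \<in> ?S" "c \<noteq> d"
      \<comment> \<open>Now \<open>y\<close>, \<open>c\<close> and \<open>d\<close> are common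
        neighbours of the pair \<open>x\<close>, \<open>b\<close>.\<close>
      have "distinct [y, c, d, x, b]" using cd dense \<open>b \<notin> ?S\<close> LB by auto
      moreover have "{y, x, b} \<in> edges G" "{c, x, b} \<in> edges G" "{d, x, b} \<in> edges G"
        using dense cd by (auto simp: insert_commute)
      ultimately have "{y, c, d} \<notin> edges G" using F32_copy[OF G] F by blast
      then show "\<exists>y\<in>{y}. {y, c, d} \<notin> edges G" by blast
    qed (use dense in auto)
  next
    case sparse
    \<comment> \<open>\<open>P\<close> holds the pairs that lie in an edge of \<open>W\<close> with
      a further vertex in \<open>L\<close>, and \<open>Q\<close> the vertices completing such a pair
      to a missing triple. Each pair of \<open>P\<close> accounts for at most \<open>s\<close> edges
      of \<open>W\<close>.\<close>
    define P where "P = {(x, b). x \<in> L \<and> b \<in> B \<and> (\<exists>y\<in>L. x \<noteq> y \<and> {x, y, b} \<in> edges G)}"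
    have fP: "finite P" using fL fB by (auto simp: P_def intro: finite_subset[of _ "L \<times> B"])
    define Q where "Q p = (case p of (x, b) \<Rightarrow> {c \<in> B - {b}. {x, b, c} \<notin> edges G})" for p
    have fQ: "finite (Q p)" for p using fB by (auto simp: Q_def split: prod.split)
    have W_P: "W \<subseteq> (\<lambda>((x, b), y). {x, y, b}) ` (P \<times> L)"
    proof
      fix e assume e: "e \<in> W"
      then obtain x y c where xyc: "x \<in> L" "y \<in> L" "x \<noteq> y" "c \<in> verts G" "e = {x, y, c}"
        using W2 by blast
      then have "c \<in> B" using sparse(1)[OF e] B by blast
      then have "(x, c) \<in> P" using xyc e W by (auto simp: P_def)
      then show "e \<in> (\<lambda>((x, b), y). {x, y, b}) ` (P \<times> L)"
        using xyc by (intro image_eqI[of _ _ "((x, c), y)"]) auto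
    qed
    moreover have "finite (P \<times> L)" using fP fL by auto
    ultimately have "card W \<le> card (P \<times> L)" by (rule surj_card_le[rotated])
    then have W_le': "card W \<le> card P * s" using L by (simp add: card_cartesian_product)
    have "P \<noteq> {}" using W_P assms(9) by auto
    then have "card P > 0" using fP by (simp add: card_gt_0_iff)
    \<comment> \<open>The \<open>2 * s\<close> pays for \<open>s\<close> edges of \<open>W\<close>
      per pair, as a missing triple is counted up to twice; the extra 1 gives strictness. The bound
      holds since the neighbours in \<open>B\<close> number at most
      \<open>?n / 3 + 1\<close>.\<close>
    have Q_large: "2 * s + 1 \<le> card (Q p)" if p: "p \<in> P" for p
    proof -
      obtain x b where xb: "p = (x, b)" by force
      let ?S = "{c \<in> B. {x, b, c} \<in> edges G}"
      define k where "k = card ?S"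
      have k: "k * (k - 1) \<le> X" using p sparse(2) unfolding xb P_def k_def by blast
      have "3 * (k - 1) \<le> ?n"
      proof (rule ccontr)
        assume "\<not> ?thesis"
        then have "?n * ?n < (3 * (k - 1)) * (3 * (k - 1))" by (intro mult_strict_mono) auto
        also have "\<dots> = 9 * ((k - 1) * (k - 1))" by simp
        also have "\<dots> \<le> 9 * (k * (k - 1))" by (intro mult_left_mono mult_right_mono) auto
        also have "\<dots> \<le> 12 * X" using k by simp
        finally show False using Xn by simp
      qed
      moreover have "B \<subseteq> insert b (Q p \<union> ?S)" by (auto simp: xb Q_def)
      then have "m \<le> card (insert b (Q p \<union> ?S))"
        unfolding m_def using fQ fB by (intro card_mono) auto
      then have "m \<le> Suc (card (Q p) + k)"
        using card_insert_le_m1 card_Un_le[of "Q p" ?S] card_insert_if[of "Q p \<union> ?S" b] fQ fB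
        unfolding k_def by (auto split: if_splits)
      ultimately show ?thesis using m ns s1 by linarith
    qed
    have "card P * (2 * s + 1) \<le> (\<Sum>p\<in>P. card (Q p))"
      using sum_mono[of P "\<lambda>_. 2 * s + 1" "\<lambda>p. card (Q p)"] Q_large by simp
    also have "\<dots> = card (Sigma P Q)" using fP fQ by (simp add: card_SigmaI)
    also have "\<dots> \<le> card (Sigma Miss (\<lambda>e. e \<inter> B))"
    proof (rule card_inj_on_le)
      \<comment> \<open>Marking \<open>b\<close> makes the map injective: \<open>x\<close> is the
        vertex of the triple in \<open>L\<close>, and \<open>c\<close> is its unmarked vertex in
        \<open>B\<close>.\<close>
      let ?f = "\<lambda>((x, b), c). ({x, b, c}, b)"
      show "inj_on ?f (Sigma P Q)"
      proof (rule inj_onI)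
        fix u v assume u: "u \<in> Sigma P Q" and v: "v \<in> Sigma P Q" and eq: "?f u = ?f v"
        obtain x b c x' b' c' where uv: "u = ((x, b), c)" "v = ((x', b'), c')"
          by (metis prod.exhaust)
        have "{x, b, c} \<inter> L = {x}" "{x, b, c} \<inter> B - {b} = {c}"
          using u LB(1) by (auto simp: uv P_def Q_def)
        moreover have "{x', b', c'} \<inter> L = {x'}" "{x', b', c'} \<inter> B - {b'} = {c'}"
          using v LB(1) by (auto simp: uv P_def Q_def)
        moreover have "{x, b, c} = {x', b', c'} \<and> b = b'"
          using eq unfolding uv prod.case prod.inject .
        ultimately show "u = v" unfolding uv by (metis singleton_inject)
      qed
      show "?f ` Sigma P Q \<subseteq> Sigma Miss (\<lambda>e. e \<inter> B)"
        using MissI by (auto simp: P_def Q_def)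
      show "finite (Sigma Miss (\<lambda>e. e \<inter> B))" using fM fB by auto
    qed
    also have "\<dots> = (\<Sum>e\<in>Miss. card (e \<inter> B))" using fM fB by (simp add: card_SigmaI)
    also have "\<dots> = 2 * card Miss"
    proof -
      have "(\<Sum>e\<in>Miss. card (e \<inter> B)) = (\<Sum>e\<in>Miss. 2)"
        by (rule sum.cong) (auto simp: Miss_def one_two_graph_def)
      then show ?thesis by simp
    qed
    finally have "2 * (card P * s) + card P \<le> 2 * card Miss" by (simp add: algebra_simps)
    then show ?thesis using W_le' \<open>card P > 0\<close> by linarith
  qed
  then show ?thesis by (simp add: Miss_def)
qed

text \<open>The edge set and the full set \<open>U\<close> of one-two triples share their
  intersection, so their sizes differ only by heavy edges against missing triples. A heavy edge
  would make \<open>G\<close> too small; without one, \<open>edges G\<close> is a subset of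
  \<open>U\<close> that is at least as large.\<close>

lemma covered_edges_eq:
  fixes G :: "'a hypergraph"
  assumes G: "three_graph G" and F: "\<not> contains_copy G F32"
    and L: "L \<subseteq> verts G" "card L = s" and n: "card (verts G) \<ge> 12 * s\<^sup>2"
    and cover: "\<And>e. e \<in> edges G \<Longrightarrow> e \<inter> L \<noteq> {}"
    and large: "card (edges G) \<ge> s * ((card (verts G) - s) choose 2)"
  shows "edges G = edges (one_two_graph L (verts G - L))"
proof -
  define U where "U = edges (one_two_graph L (verts G - L))"
  have fV: "finite (verts G)" using three_graphD(1)[OF G] .
  have fL: "finite L" using finite_subset[OF L(1) fV] .
  have cU: "card U = s * ((card (verts G) - s) choose 2)"
    using card_pair_triples[of L "verts G - L"] fV fL L
    by (simp add: U_def one_two_graph_def card_Diff_subset)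
  have "U \<subseteq> Pow (verts G)" using L by (auto simp: U_def one_two_graph_def)
  then have fU: "finite U" using fV by (meson finite_Pow_iff finite_subset)
  have fE: "finite (edges G)" using three_graphD(5)[OF G] .
  have c1: "card (edges G) = card (edges G \<inter> U) + card (edges G - U)"
    using card_Int_Diff[OF fE] .
  have c2: "card U = card (edges G \<inter> U) + card (U - edges G)"
    using card_Int_Diff[OF fU, of "edges G"] by (simp add: Int_commute)
  have "edges G - U = {}"
  proof (rule ccontr)
    assume "edges G - U \<noteq> {}"
    then have "card (edges G - U) < card (U - edges G)"
      unfolding U_def by (intro heavy_edges_lt_missing[OF G F L n cover refl refl])
    then show False using c1 c2 cU large by linarith
  qed
  then have "edges G \<subseteq> U" by blast
  moreover have "card U \<le> card (edges G)" using cU large by simp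
  ultimately show ?thesis using card_seteq[OF fU] by (simp add: U_def)
qed

subsection \<open>The extremal graph\<close>

lemma three_graph_one_two_graph:
  assumes "finite A" "finite B" "A \<inter> B = {}"
  shows "three_graph (one_two_graph A B)"
  unfolding three_graph_def
proof (intro conjI ballI)
  fix e assume "e \<in> edges (one_two_graph A B)"
  then have e: "e \<subseteq> A \<union> B" "card (e \<inter> A) = 1" "card (e \<inter> B) = 2"
    by (auto simp: one_two_graph_def)
  then show "e \<subseteq> verts (one_two_graph A B)" by (simp add: one_two_graph_def)
  have "(e \<inter> A) \<union> (e \<inter> B) = e" "(e \<inter> A) \<inter> (e \<inter> B) = {}" using e(1) assms(3) by auto
  then show "card e = 3"
    using card_Un_disjoint[of "e \<inter> A" "e \<inter> B"] e assms by simp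
qed (use assms in \<open>simp add: one_two_graph_def\<close>)

text \<open>With \<open>c i\<close> indicating whether vertex \<open>i\<close> of the copy lies in \<open>A\<close>, the edges through 4 and 5
  give \<open>c 1 = c 2 = c 3\<close>, so \<open>c 1 + c 2 + c 3\<close> cannot be 1.\<close>

lemma one_two_graph_F32_free: "\<not> contains_copy (one_two_graph A B) F32"
proof
  assume "contains_copy (one_two_graph A B) F32"
  then obtain f where f: "inj_on f (verts F32)"
    "\<forall>e\<in>edges F32. f ` e \<in> edges (one_two_graph A B)"
    unfolding contains_copy_def by blast
  have inj: "inj_on f {1, 2, 3, 4, 5}" using f(1) by (simp add: F32_def)
  have E: "card (f ` e \<inter> A) = 1" if "e \<in> {{1, 2, 3}, {1, 4, 5}, {2, 4, 5}, {3, 4, 5}}" for e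
  proof -
    have "e \<in> edges F32" using that by (simp only: F32_def hypergraph.simps)
    then have "f ` e \<in> edges (one_two_graph A B)" using f(2) by blast
    then show ?thesis by (simp add: one_two_graph_def)
  qed
  define c :: "nat \<Rightarrow> nat" where "c i = of_bool (f i \<in> A)" for i
  have "c i + c j + c k = 1"
    if "{i, j, k} \<in> {{1, 2, 3}, {1, 4, 5}, {2, 4, 5}, {3, 4, 5}}"
      and d: "distinct [f i, f j, f k]" for i j k
  proof -
    have "card ({f i, f j, f k} \<inter> A) = c i + c j + c k"
      using d by (auto simp: c_def Int_insert_left)
    then show ?thesis using E[OF that(1)] by simp
  qed
  moreover have "distinct [f 1, f 2, f 3]" "distinct [f 1, f 4, f 5]"
    "distinct [f 2, f 4, f 5]" "distinct [f 3, f 4, f 5]"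
    using inj by (simp_all add: inj_on_def)
  ultimately have "c 1 + c 2 + c 3 = 1" "c 1 + c 4 + c 5 = 1" "c 2 + c 4 + c 5 = 1"
    "c 3 + c 4 + c 5 = 1" by blast+
  then show False by presburger
qed

text \<open>Disjoint edges use distinct vertices of \<open>A\<close>, one each, so a matching has at
  most \<open>card A\<close> edges.\<close>

lemma one_two_graph_matching_free:
  assumes "finite A" "card A < k"
  shows "\<not> contains_copy (one_two_graph A B) (matching3 k)"
proof
  assume "contains_copy (one_two_graph A B) (matching3 k)"
  then obtain f where f: "inj_on f (verts (matching3 k))"
    "\<forall>e\<in>edges (matching3 k). f ` e \<in> edges (one_two_graph A B)"
    unfolding contains_copy_def by blast
  have inj: "inj_on f {..<3 * k}" using f(1) by (simp add: matching3_def)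
  have E: "card (f ` {3 * i, 3 * i + 1, 3 * i + 2} \<inter> A) = 1" if "i < k" for i
  proof -
    have "{3 * i, 3 * i + 1, 3 * i + 2} \<in> edges (matching3 k)"
      using that unfolding matching3_def hypergraph.simps by blast
    then have "f ` {3 * i, 3 * i + 1, 3 * i + 2} \<in> edges (one_two_graph A B)" using f(2) by blast
    then show ?thesis unfolding one_two_graph_def hypergraph.simps by blast
  qed
  have "\<exists>p\<in>{3 * i, 3 * i + 1, 3 * i + 2}. f p \<in> A" if "i < k" for i
  proof -
    have "f ` {3 * i, 3 * i + 1, 3 * i + 2} \<inter> A \<noteq> {}" using E[OF that] by fastforce
    then show ?thesis by blast
  qed
  then obtain p where p: "\<And>i. i < k \<Longrightarrow> p i \<in> {3 * i, 3 * i + 1, 3 * i + 2} \<and> f (p i) \<in> A"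
    by metis
  have "card {..<k} \<le> card A"
  proof (rule card_inj_on_le)
    show "inj_on (\<lambda>i. f (p i)) {..<k}"
    proof (rule inj_onI)
      fix i j assume ij: "i \<in> {..<k}" "j \<in> {..<k}" "f (p i) = f (p j)"
      have b: "3 * i \<le> p i" "p i \<le> 3 * i + 2" "3 * j \<le> p j" "p j \<le> 3 * j + 2"
        using p[of i] p[of j] ij(1,2) by auto
      then have "p i < 3 * k" "p j < 3 * k" using ij(1,2) by auto
      then have "p i = p j" using inj ij(3) by (auto simp: inj_on_def)
      then show "i = j" using b by linarith
    qed
  qed (use p assms in auto)
  then show False using assms by simp
qed

text \<open>Bijections between the corresponding parts glue to one bijection that preserves how many
  vertices of a set lie in each part, and these two numbers decide which sets are edges.\<close>

lemma isomorphic_one_two_graph: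
  assumes G: "verts G = A \<union> B" "edges G = edges (one_two_graph A B)"
    and fin: "finite A" "finite B" "finite A'" "finite B'"
    and disj: "A \<inter> B = {}" "A' \<inter> B' = {}"
    and card: "card A = card A'" "card B = card B'"
  shows "isomorphic G (one_two_graph A' B')"
proof -
  obtain g where g: "bij_betw g A A'" using finite_same_card_bij fin card by blast
  obtain h where h: "bij_betw h B B'" using finite_same_card_bij fin card by blast
  define f where "f x = (if x \<in> A then g x else h x)" for x
  have bij: "bij_betw f (A \<union> B) (A' \<union> B')"
    unfolding f_def using bij_betw_disjoint_Un[OF g h disj] .
  have fA: "f ` A = A'" using g by (auto simp: f_def bij_betw_def)
  have fB: "f ` B = B'"
  proof -
    have "f ` B = h ` B" using disj by (intro image_cong) (auto simp: f_def)
    then show ?thesis using h by (simp add: bij_betw_def)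
  qed
  have inj: "inj_on f (A \<union> B)" using bij by (rule bij_betw_imp_inj_on)
  have eq: "card (f ` e \<inter> A') = card (e \<inter> A)" "card (f ` e \<inter> B') = card (e \<inter> B)"
    if e: "e \<subseteq> A \<union> B" for e
  proof -
    have "f ` (e \<inter> A) = f ` e \<inter> A'" "f ` (e \<inter> B) = f ` e \<inter> B'"
      using inj_on_image_Int[OF inj e, of A] inj_on_image_Int[OF inj e, of B] fA fB by auto
    moreover have "inj_on f (e \<inter> A)" "inj_on f (e \<inter> B)" using inj_on_subset[OF inj] e by blast+
    ultimately show "card (f ` e \<inter> A') = card (e \<inter> A)" "card (f ` e \<inter> B') = card (e \<inter> B)"
      by (metis card_image)+
  qed
  have "edges (one_two_graph A' B') = (\<lambda>e. f ` e) ` edges G"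
  proof (intro set_eqI iffI)
    fix e' assume e': "e' \<in> edges (one_two_graph A' B')"
    then have "e' \<subseteq> f ` (A \<union> B)" using fA fB by (auto simp: one_two_graph_def)
    then obtain e where e: "e \<subseteq> A \<union> B" "e' = f ` e" by (auto simp: subset_image_iff)
    then have "e \<in> edges G" using e' eq[OF e(1)] G(2) by (simp add: one_two_graph_def)
    then show "e' \<in> (\<lambda>e. f ` e) ` edges G" using e by blast
  next
    fix e' assume "e' \<in> (\<lambda>e. f ` e) ` edges G"
    then obtain e where e: "e' = f ` e" "e \<subseteq> A \<union> B" "card (e \<inter> A) = 1" "card (e \<inter> B) = 2"
      using G(2) by (auto simp: one_two_graph_def)
    moreover have "f ` e \<subseteq> A' \<union> B'" using e(2) fA fB by blast
    ultimately show "e' \<in> edges (one_two_graph A' B')" using eq[OF e(2)]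
      by (simp add: one_two_graph_def)
  qed
  then show ?thesis
    unfolding isomorphic_def using bij G(1) by (intro exI[of _ f]) (simp add: one_two_graph_def)
qed

text \<open>Assuming only a lower bound on the number of edges lets this serve both the upper bound
  on \<open>ex\<close> and uniqueness.\<close>

lemma large_free_is_one_two_graph:
  assumes s: "s \<ge> 1" and G: "three_graph G" and n: "card (verts G) \<ge> 12 * s\<^sup>2"
    and free: "family_free G {F32, matching3 (s + 1)}"
    and large: "card (edges G) \<ge> s * ((card (verts G) - s) choose 2)"
  shows "\<exists>L\<subseteq>verts G. card L = s \<and> edges G = edges (one_two_graph L (verts G - L))"
proof -
  have F: "\<not> contains_copy G F32" and M: "\<not> contains_copy G (matching3 (s + 1))"
    using free by (auto simp: family_free_def)
  obtain L where "L \<subseteq> verts G" "card L = s" "\<And>e. e \<in> edges G \<Longrightarrow> e \<inter> L \<noteq> {}"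
    using vertex_cover_of_size[OF G s n matching_card_le[OF G M] large] by blast
  then show ?thesis using covered_edges_eq[OF G F _ _ n _ large] by blast
qed

theorem theorem1p8:
  fixes n s :: nat
  assumes "s \<ge> 1" and "n \<ge> 12 * s^2"
  shows "ex n {F32, matching3 (s + 1)} = s * ((n - s) choose 2)
    \<and> (three_graph (H_graph n s) \<and> card (verts (H_graph n s)) = n
       \<and> family_free (H_graph n s) {F32, matching3 (s + 1)}
       \<and> card (edges (H_graph n s)) = s * ((n - s) choose 2))
    \<and> (\<forall>G :: 'a hypergraph.
         three_graph G \<and> card (verts G) = n \<and> family_free G {F32, matching3 (s + 1)}
         \<and> card (edges G) = s * ((n - s) choose 2)
         \<longrightarrow> isomorphic G (H_graph n s))"
proof -
  have "s \<le> s * s" by simp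
  then have sn: "s \<le> n" using assms(2) unfolding power2_eq_square by linarith
  have AB: "{..<s} \<inter> {s..<n} = {}" "{..<s} \<union> {s..<n} = {..<n}" using sn by auto
  have H: "three_graph (H_graph n s)" "card (verts (H_graph n s)) = n"
    unfolding H_graph_def
    using three_graph_one_two_graph[OF _ _ AB(1)] AB(2) by (simp_all add: one_two_graph_def)
  have free: "family_free (H_graph n s) {F32, matching3 (s + 1)}"
    unfolding H_graph_def family_free_def
    using one_two_graph_F32_free one_two_graph_matching_free[of "{..<s}" "s + 1"] by simp
  have HE: "card (edges (H_graph n s)) = s * ((n - s) choose 2)"
    using card_pair_triples[OF _ _ AB(1)] by (simp add: H_graph_def one_two_graph_def)
  have card_bound: "m \<le> s * ((n - s) choose 2)" if "m \<in> free_sizes n {F32, matching3 (s + 1)}" for m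
  proof (rule ccontr)
    assume less: "\<not> ?thesis"
    obtain G :: "nat hypergraph" where G: "m = card (edges G)" "three_graph G"
      "card (verts G) = n" "family_free G {F32, matching3 (s + 1)}"
      using \<open>m \<in> _\<close> by (auto simp: free_sizes_def)
    \<comment> \<open>A graph with too many edges would also be a one-two graph, whose edge count is
      exactly the claimed maximum.\<close>
    obtain L where L: "L \<subseteq> verts G" "card L = s" "edges G = edges (one_two_graph L (verts G - L))"
      using large_free_is_one_two_graph[OF assms(1) G(2) _ G(4)] assms(2) G(1,3) less by auto
    have fL: "finite L" "finite (verts G)"
      using finite_subset[OF L(1)] three_graphD(1)[OF G(2)] by auto
    then have "card (edges G) = s * ((n - s) choose 2)"
      using card_pair_triples[of L "verts G - L"] L G(3)
      by (simp add: one_two_graph_def card_Diff_subset)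
    then show False using less G(1) by simp
  qed
  have "ex n {F32, matching3 (s + 1)} = s * ((n - s) choose 2)"
    unfolding ex_def
  proof (rule Max_eqI[OF finite_free_sizes card_bound])
    show "s * ((n - s) choose 2) \<in> free_sizes n {F32, matching3 (s + 1)}"
      unfolding free_sizes_def mem_Collect_eq
      using H free HE by (intro exI[of _ "H_graph n s"]) simp
  qed
  moreover have "isomorphic G (H_graph n s)"
    if G: "three_graph G" "card (verts G) = n" "family_free G {F32, matching3 (s + 1)}"
      "card (edges G) = s * ((n - s) choose 2)" for G :: "'a hypergraph"
  proof -
    obtain L where L: "L \<subseteq> verts G" "card L = s" "edges G = edges (one_two_graph L (verts G - L))"
      using large_free_is_one_two_graph[OF assms(1) G(1) _ G(3)] assms(2) G(2,4) by auto
    have "finite L" "finite (verts G)"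
      using finite_subset[OF L(1)] three_graphD(1)[OF G(1)] by auto
    then show ?thesis
      unfolding H_graph_def using L G(2)
      by (intro isomorphic_one_two_graph[of G L "verts G - L"]) (auto simp: card_Diff_subset)
  qed
  ultimately show ?thesis using H free HE by blast
qed

end
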